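(* Let $\Omega\subset\mathbb{R}^n$ be a bounded open set with $|\Omega|=1$. Let $1<p<\infty$, $0<\theta<1$ and $1\le r<\infty$. Then there is a constant $c>0$ such that for all $f\in (L^{p,\infty}(\Omega),L^{(p}(\Omega))_{\theta,1}$, $$\|f\|_{G\Gamma(p,r;w_1,w_2)\cap G\Gamma(\infty,r;v_1,v_2)}\le c\,\|f\|_{(L^{p,\infty},L^{(p})_{\theta,1}},$$ where $w_1(t)=t^{-1}(1-\log t)^{r\theta-1}$, $w_2(t)=(1-\log t)^{-1}$, $v_1(t)=t^{-1}(1-\log t)^{r\theta(1-1/p)-1}$ and $v_2(t)=t^{1/p}$.
   Context: $\log$ is the natural logarithm. For measurable $f:\Omega\to\mathbb{R}$, $f_*$ is the decreasing rearrangement of $|f|$ on $(0,1)$: $f_*(s)=\inf\{t\ge0:|\{x:|f(x)|>t\}|\le s\}$, and $f_*^p=(f_* )^p$. Norms: $\|f\|_{L^{p,\infty}}=\sup_{0<s<1}s^{1/p}f_*(s)$; small Lebesgue space $L^{(p}$: $\|f\|_{L^{(p}}=\int_0^1(1-\log t)^{-1/p}\left(\int_0^t f_*^p(\sigma)\,d\sigma\right)^{1/p}\frac{dt}{t}$. $\|f\|_{G\Gamma(p,r;w_1,w_2)}=\left[\int_0^1 w_1(t)\left(\int_0^t f_*^p(\sigma)w_2(\sigma)\,d\sigma\right)^{r/p}dt\right]^{1/r}$ for $p<\infty$, and $\|f\|_{G\Gamma(\infty,r;v_1,v_2)}=\left[\int_0^1 v_1(t)\left(\sup_{0<s<t}v_2(s)f_*(s)\right)^{r}dt\right]^{1/r}$.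 The norm on an intersection of two spaces is the maximum of the two norms. For a compatible couple $(X_0,X_1)$, $K(f,t;X_0,X_1)=\inf_{f=f_0+f_1}(\|f_0\|_{X_0}+t\|f_1\|_{X_1})$ and, for $0<\theta<1$, $1\le q<\infty$, $\|f\|_{(X_0,X_1)_{\theta,q}}=\left(\int_0^1[t^{-\theta}K(f,t;X_0,X_1)]^q\frac{dt}{t}\right)^{1/q}$. *)

theory Defs
  imports "HOL-Analysis.Analysis"
begin

(* Real powers of extended nonnegative numbers. Only exponents a > 0 are used, so the
   value at infinity is infinity and the value at 0 is 0. *)
definition epowr :: "ennreal \<Rightarrow> real \<Rightarrow> ennreal" where
  "epowr x a = (if x = \<infinity> then \<infinity> else ennreal (enn2real x powr a))"

(* Functions on Om are represented by total functions on R^n; their values outside Om are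
   irrelevant throughout. The infimum is taken in ennreal, so that of the empty set is infinity. *)
definition rearr :: "(real^'n) set \<Rightarrow> (real^'n \<Rightarrow> real) \<Rightarrow> real \<Rightarrow> ennreal" where
  "rearr Om f s =
     (INF t \<in> {t. 0 \<le> t \<and> emeasure lebesgue {x \<in> Om. \<bar>f x\<bar> > t} \<le> ennreal s}. ennreal t)"

definition weak_Lp_norm :: "(real^'n) set \<Rightarrow> real \<Rightarrow> (real^'n \<Rightarrow> real) \<Rightarrow> ennreal" where
  "weak_Lp_norm Om p f = (SUP s \<in> {0<..<1}. ennreal (s powr (1 / p)) * rearr Om f s)"

definition small_Lp_norm :: "(real^'n) set \<Rightarrow> real \<Rightarrow> (real^'n \<Rightarrow> real) \<Rightarrow> ennreal" where
  "small_Lp_norm Om p f =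
     (\<integral>\<^sup>+ t \<in> {0<..<1}.
        ennreal ((1 - ln t) powr (- (1 / p)))
        * epowr (\<integral>\<^sup>+ \<sigma> \<in> {0<..<t}. epowr (rearr Om f \<sigma>) p \<partial>lborel) (1 / p)
        * ennreal (1 / t) \<partial>lborel)"

definition GGamma_norm ::
  "(real^'n) set \<Rightarrow> real \<Rightarrow> real \<Rightarrow> (real \<Rightarrow> real) \<Rightarrow> (real \<Rightarrow> real) \<Rightarrow> (real^'n \<Rightarrow> real) \<Rightarrow> ennreal" where
  "GGamma_norm Om p r w1 w2 f =
     epowr (\<integral>\<^sup>+ t \<in> {0<..<1}.
        ennreal (w1 t)
        * epowr (\<integral>\<^sup>+ \<sigma> \<in> {0<..<t}. epowr (rearr Om f \<sigma>) p * ennreal (w2 \<sigma>) \<partial>lborel) (r / p)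
        \<partial>lborel) (1 / r)"

definition GGamma_inf_norm ::
  "(real^'n) set \<Rightarrow> real \<Rightarrow> (real \<Rightarrow> real) \<Rightarrow> (real \<Rightarrow> real) \<Rightarrow> (real^'n \<Rightarrow> real) \<Rightarrow> ennreal" where
  "GGamma_inf_norm Om r v1 v2 f =
     epowr (\<integral>\<^sup>+ t \<in> {0<..<1}.
        ennreal (v1 t) * epowr (SUP s \<in> {0<..<t}. ennreal (v2 s) * rearr Om f s) r
        \<partial>lborel) (1 / r)"

definition inter_norm ::
  "((real^'n \<Rightarrow> real) \<Rightarrow> ennreal) \<Rightarrow> ((real^'n \<Rightarrow> real) \<Rightarrow> ennreal) \<Rightarrow> (real^'n \<Rightarrow> real) \<Rightarrow> ennreal" where
  "inter_norm N M f = max (N f) (M f)"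

definition norm_space ::
  "(real^'n) set \<Rightarrow> ((real^'n \<Rightarrow> real) \<Rightarrow> ennreal) \<Rightarrow> (real^'n \<Rightarrow> real) set" where
  "norm_space Om N = {f. f \<in> borel_measurable (lebesgue_on Om) \<and> N f < \<infinity>}"

(* Elements of the spaces stand for classes modulo equality almost everywhere on Om, so the
   identity f = g + h is only required almost everywhere. *)
definition decomps ::
  "(real^'n) set \<Rightarrow> ((real^'n \<Rightarrow> real) \<Rightarrow> ennreal) \<Rightarrow> ((real^'n \<Rightarrow> real) \<Rightarrow> ennreal) \<Rightarrow>
   (real^'n \<Rightarrow> real) \<Rightarrow> ((real^'n \<Rightarrow> real) \<times> (real^'n \<Rightarrow> real)) set" where
  "decomps Om N0 N1 f =
     {(g, h). g \<in> norm_space Om N0 \<and> h \<in> norm_space Om N1 \<and>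
              (AE x in lebesgue_on Om. f x = g x + h x)}"

definition K_fun ::
  "(real^'n) set \<Rightarrow> ((real^'n \<Rightarrow> real) \<Rightarrow> ennreal) \<Rightarrow> ((real^'n \<Rightarrow> real) \<Rightarrow> ennreal) \<Rightarrow>
   (real^'n \<Rightarrow> real) \<Rightarrow> real \<Rightarrow> ennreal" where
  "K_fun Om N0 N1 f t = (INF (g, h) \<in> decomps Om N0 N1 f. N0 g + ennreal t * N1 h)"

(* Unlike in the usual definition, the integral runs over (0,1) and not over (0,infinity). *)
definition interp_norm ::
  "(real^'n) set \<Rightarrow> ((real^'n \<Rightarrow> real) \<Rightarrow> ennreal) \<Rightarrow> ((real^'n \<Rightarrow> real) \<Rightarrow> ennreal) \<Rightarrow>
   real \<Rightarrow> real \<Rightarrow> (real^'n \<Rightarrow> real) \<Rightarrow> ennreal" where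
  "interp_norm Om N0 N1 \<theta> q f =
     epowr (\<integral>\<^sup>+ t \<in> {0<..<1}.
        epowr (ennreal (t powr (- \<theta>)) * K_fun Om N0 N1 f t) q * ennreal (1 / t)
        \<partial>lborel) (1 / q)"

definition interp_space ::
  "(real^'n) set \<Rightarrow> ((real^'n \<Rightarrow> real) \<Rightarrow> ennreal) \<Rightarrow> ((real^'n \<Rightarrow> real) \<Rightarrow> ennreal) \<Rightarrow>
   real \<Rightarrow> real \<Rightarrow> (real^'n \<Rightarrow> real) set" where
  "interp_space Om N0 N1 \<theta> q =
     {f. f \<in> borel_measurable (lebesgue_on Om) \<and> decomps Om N0 N1 f \<noteq> {} \<and>
         interp_norm Om N0 N1 \<theta> q f < \<infinity>}"

end

theory Submission
  imports Defs
begin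

text \<open>
  Write \<open>u = 1 - ln t\<close>, let \<open>K(s)\<close> be the K-functional of \<open>f\<close> for the couple
  (weak \<open>L^p\<close>, small \<open>L^p\<close>), and let \<open>N\<close> be the interpolation norm of \<open>f\<close>, which is the
  integral of \<open>s^(-\<theta>) K(s) / s\<close> over \<open>(0,1)\<close>. Both norms on the left are weighted \<open>L^r\<close> norms
  in \<open>t\<close> of a functional that only sees the decreasing rearrangement \<open>f_*\<close> on \<open>(0,t)\<close>:
    \<open>G(t) = (\<integral>_0^t f_*(\<sigma>)^p (1 - ln \<sigma>)^(-1) d\<sigma>)^(1/p)\<close> and \<open>S(t) = sup_{s<t} s^(1/p) f_*(s)\<close>.
  The proof bounds each of them pointwise by the Hardy integral \<open>L(x) = \<integral>_0^x K(s)/s ds\<close>, taken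
  at \<open>x = 1/u\<close> for \<open>G\<close> and at \<open>x = u^(-(1-1/p))\<close> for \<open>S\<close>, and then applies a Hardy inequality to
  \<open>L\<close>.

  Pointwise bounds. If \<open>f = g + h\<close>, then \<open>f_*(s) \<le> g_*(s/2) + h_*(s/2)\<close>. The small \<open>L^p\<close> norm of
  \<open>h\<close> integrates the nondecreasing function \<open>(\<integral>_0^t h_*^p)^(1/p)\<close> against \<open>u^(-1/p) dt/t\<close>, whose mass
  on \<open>(t,1)\<close> is comparable to \<open>u^(1-1/p)\<close> for \<open>t \<le> 1/2\<close>; hence \<open>(\<integral>_0^t h_*^p)^(1/p)\<close> is at most a constant times
  \<open>u^(-(1-1/p))\<close> times that norm (\<open>small_Lp_norm_controls_integral\<close>). Since \<open>s^(1/p) g_*(s)\<close> is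
  bounded by the weak norm of \<open>g\<close>, taking the infimum over all decompositions bounds \<open>S(t)\<close> by
  \<open>K(u^(-(1-1/p)))\<close> (\<open>sup_rearr_le_K_fun\<close>). The same argument fails for \<open>G\<close>, because
  \<open>\<integral>_0^t (1 - ln \<sigma>)^(-1) d\<sigma>/\<sigma>\<close> diverges and so the weak norm of \<open>g\<close> does not control its part.
  It does work on a block of \<open>(0,t)\<close> on which \<open>1 - ln \<sigma>\<close> at most doubles (\<open>block_le_K_fun\<close>). With
  one decomposition for each of the blocks that make up \<open>(0,t)\<close>, \<open>G(t)\<close> is bounded by the sum of
  \<open>K(2^(-j)/u)\<close> over \<open>j\<close>, and hence by \<open>L(1/u)\<close>, as \<open>K(s)/s\<close> is nonincreasing
  (\<open>integral_le_hardy_integral_of_blocks\<close>).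

  Hardy inequality. Trivially \<open>x^(-\<theta>) L(x) \<le> N\<close> for \<open>x \<le> 1\<close>, and Tonelli's theorem bounds the
  integral of \<open>x^(-\<theta>) L(x)\<close> with respect to the logarithmic measure by a multiple of \<open>N\<close>
  (\<open>hardy_inequality_log\<close>). The \<open>L^\<infinity>\<close> and the \<open>L^1\<close> bound together give the \<open>L^r\<close> bound for
  every \<open>r \<ge> 1\<close> (\<open>log_weighted_norm_le\<close>).
\<close>

section \<open>Real powers of extended nonnegative numbers\<close>

lemma epowr_ennreal: "0 \<le> x \<Longrightarrow> epowr (ennreal x) a = ennreal (x powr a)"
  by (simp add: epowr_def)

lemma epowr_0 [simp]: "epowr 0 a = 0"
  by (simp add: epowr_def)

lemma epowr_1 [simp]: "epowr x 1 = x"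
  by (cases x) (auto simp: epowr_def)

lemma epowr_mono: "x \<le> y \<Longrightarrow> 0 \<le> a \<Longrightarrow> epowr x a \<le> epowr y a"
  by (cases x; cases y) (auto simp: epowr_def top_unique intro!: powr_mono2)

lemma epowr_epowr: "epowr (epowr x a) b = epowr x (a * b)"
  by (cases x) (auto simp: epowr_def powr_powr)

lemma epowr_mult: "epowr (x * y) a = epowr x a * epowr y a"
proof (cases x; cases y)
  show ?thesis if "x = ennreal s" "0 \<le> s" "y = ennreal t" "0 \<le> t" for s t
    using that by (simp add: epowr_ennreal powr_mult flip: ennreal_mult)
qed (auto simp: epowr_def ennreal_mult_top ennreal_top_mult)

lemma epowr_inverse_cancel: "a \<noteq> 0 \<Longrightarrow> epowr (epowr x a) (1 / a) = x"
  "a \<noteq> 0 \<Longrightarrow> epowr (epowr x (1 / a)) a = x"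
  by (simp_all add: epowr_epowr)

text \<open>This is how an \<open>L^\<infinity>\<close> bound and an \<open>L^1\<close> bound are combined into an \<open>L^r\<close> bound.\<close>

lemma epowr_le_mult_powr:
  assumes "x \<le> ennreal n" "0 \<le> n" "1 \<le> r"
  shows "epowr x r \<le> x * ennreal (n powr (r - 1))"
proof -
  obtain s where s: "x = ennreal s" "0 \<le> s"
    using assms by (cases x) (auto simp: top_unique)
  have "s powr r = s * s powr (r - 1)"
    using s by (cases "s = 0") (auto simp: powr_mult_base)
  also have "\<dots> \<le> s * n powr (r - 1)"
    using s assms by (intro mult_left_mono powr_mono2) auto
  finally show ?thesis
    using s by (simp add: epowr_ennreal flip: ennreal_mult)
qed

text \<open>Since \<open>x^p \<le> x (x + y)^(p-1)\<close>, and likewise for \<open>y\<close>. This adds the estimates of successive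
  blocks while they stay \<open>p\<close>-th powers.\<close>

lemma epowr_superadditive:
  assumes "1 \<le> p"
  shows "epowr x p + epowr y p \<le> epowr (x + y) p"
proof (cases "x + y = \<infinity>")
  case True
  then show ?thesis by (simp add: epowr_def)
next
  case False
  then obtain n where n: "x + y = ennreal n" "0 \<le> n"
    by (cases "x + y") auto
  have "epowr x p + epowr y p
      \<le> x * ennreal (n powr (p - 1)) + y * ennreal (n powr (p - 1))"
    using assms n by (intro add_mono epowr_le_mult_powr) (auto simp flip: n(1))
  also have "\<dots> = epowr (x + y) p"
    unfolding distrib_right[symmetric] n(1)
    using n(2) assms by (cases "n = 0") (auto simp: epowr_ennreal powr_mult_base simp flip: ennreal_mult)
  finally show ?thesis .
qed

lemma epowr_add_le:
  assumes "0 \<le> p"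
  shows "epowr (x + y) p \<le> ennreal (2 powr p) * (epowr x p + epowr y p)"
proof -
  have "epowr (x + y) p \<le> epowr (ennreal 2 * max x y) p"
    using assms by (intro epowr_mono) (auto simp: mult_2 add_mono)
  also have "\<dots> = ennreal (2 powr p) * epowr (max x y) p"
    by (subst epowr_mult, subst epowr_ennreal) auto
  also have "\<dots> \<le> ennreal (2 powr p) * (epowr x p + epowr y p)"
    by (intro mult_left_mono) (auto simp: max_def add_increasing add_increasing2)
  finally show ?thesis .
qed

lemma epowr_le_imp_le:
  assumes "epowr X (1 / p) \<le> Y" "0 < p"
  shows "X \<le> epowr Y p"
  using epowr_mono[OF assms(1), of p] assms(2) by (simp add: epowr_inverse_cancel)

section \<open>Monotone functions and decreasing rearrangements\<close>

lemma borel_measurable_mono_ennreal: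
  fixes f :: "real \<Rightarrow> ennreal"
  assumes "mono f"
  shows "f \<in> borel_measurable borel"
proof (rule borel_measurableI_greater)
  fix y
  have "is_interval {x. y < f x}"
    using assms by (auto simp: is_interval_1 mono_def intro: less_le_trans)
  then show "{x \<in> space borel. y < f x} \<in> sets borel"
    by (simp add: real_interval_borel_measurable)
qed

lemma borel_measurable_antimono_ennreal:
  fixes f :: "real \<Rightarrow> ennreal"
  assumes "antimono f"
  shows "f \<in> borel_measurable borel"
proof (rule borel_measurableI_greater)
  fix y
  have "is_interval {x. y < f x}"
    using assms by (auto simp: is_interval_1 antimono_def intro: less_le_trans)
  then show "{x \<in> space borel. y < f x} \<in> sets borel"
    by (simp add: real_interval_borel_measurable)
qed

lemma epowr_measurable [measurable]:
  assumes [measurable]: "f \<in> borel_measurable M"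
  shows "(\<lambda>x. epowr (f x) a) \<in> borel_measurable M"
  unfolding epowr_def by measurable

lemma antimono_rearr: "antimono (rearr Om f)"
proof (rule antimonoI)
  fix s t :: real
  assume "s \<le> t"
  then show "rearr Om f t \<le> rearr Om f s"
    unfolding rearr_def
    by (intro INF_superset_mono order_refl Collect_mono conj_mono impI)
      (auto intro: order_trans[OF _ ennreal_leI])
qed

lemma rearr_antimono: "s \<le> t \<Longrightarrow> rearr Om f t \<le> rearr Om f s"
  using antimono_rearr by (auto simp: antimono_def)

lemma rearr_measurable [measurable]: "rearr Om f \<in> borel_measurable borel"
  by (rule borel_measurable_antimono_ennreal[OF antimono_rearr])

text \<open>The two infima are attacked one at a time, by moving the other summand to the left; the
  cases in which truncated subtraction of infinity would lose information are trivial.\<close>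

lemma le_INF_add_INF_ennreal:
  fixes c :: ennreal
  assumes "\<And>a b. a \<in> A \<Longrightarrow> b \<in> B \<Longrightarrow> c \<le> f a + g b"
  shows "c \<le> (INF a\<in>A. f a) + (INF b\<in>B. g b)"
proof (cases "(INF a\<in>A. f a) = top \<or> (INF b\<in>B. g b) = top")
  case True
  then show ?thesis by auto
next
  case False
  have "c \<le> f a + (INF b\<in>B. g b)" if "a \<in> A" for a
  proof (cases "f a = top")
    case False
    then have "c - f a \<le> (INF b\<in>B. g b)"
      using assms[OF that] by (intro INF_greatest) (auto simp: ennreal_minus_le_iff)
    then show ?thesis
      using False by (auto simp: ennreal_minus_le_iff)
  qed auto
  then have "c - (INF b\<in>B. g b) \<le> f a" if "a \<in> A" for a
    unfolding ennreal_minus_le_iff using that False by (metis add.commute)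
  then have "c - (INF b\<in>B. g b) \<le> (INF a\<in>A. f a)"
    by (intro INF_greatest)
  then show ?thesis
    using False by (simp add: ennreal_minus_le_iff add.commute)
qed

text \<open>If \<open>\<bar>f\<bar> > s + t\<close> at a point, then \<open>\<bar>g\<bar> > s\<close> or \<open>\<bar>h\<bar> > t\<close> there, up to a null set; so the
  measures of the level sets add up.\<close>

lemma rearr_add:
  fixes Om :: "(real^'n) set"
  assumes Om: "Om \<in> sets lebesgue"
    and g: "g \<in> borel_measurable (lebesgue_on Om)"
    and h: "h \<in> borel_measurable (lebesgue_on Om)"
    and fgh: "AE x in lebesgue_on Om. f x = g x + h x"
    and "0 \<le> a" "0 \<le> b"
  shows "rearr Om f (a + b) \<le> rearr Om g a + rearr Om h b"
  unfolding rearr_def[of Om g] rearr_def[of Om h]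
proof (rule le_INF_add_INF_ennreal, clarify)
  fix s t :: real
  assume s: "0 \<le> s" "emeasure lebesgue {x \<in> Om. \<bar>g x\<bar> > s} \<le> ennreal a"
    and t: "0 \<le> t" "emeasure lebesgue {x \<in> Om. \<bar>h x\<bar> > t} \<le> ennreal b"
  have level: "{x \<in> Om. \<bar>k x\<bar> > c} \<in> sets lebesgue"
    if k: "k \<in> borel_measurable (lebesgue_on Om)" for k :: "real^'n \<Rightarrow> real" and c
  proof -
    have "{x \<in> space (lebesgue_on Om). \<bar>k x\<bar> > c} \<in> sets (lebesgue_on Om)"
      using k by measurable
    then show ?thesis
      using Om by (simp add: sets_restrict_space_iff space_restrict_space)
  qed
  have "AE x in lebesgue. x \<in> Om \<longrightarrow> f x = g x + h x"
    using fgh Om by (subst (asm) AE_restrict_space_iff) auto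
  then obtain N where N: "N \<in> null_sets lebesgue" "{x. \<not> (x \<in> Om \<longrightarrow> f x = g x + h x)} \<subseteq> N"
    unfolding eventually_ae_filter by auto
  let ?G = "{x \<in> Om. \<bar>g x\<bar> > s}" and ?H = "{x \<in> Om. \<bar>h x\<bar> > t}"
  have "emeasure lebesgue {x \<in> Om. \<bar>f x\<bar> > s + t} \<le> emeasure lebesgue (?G \<union> ?H \<union> N)"
    using N level[OF g] level[OF h] by (intro emeasure_mono) auto
  also have "\<dots> = emeasure lebesgue (?G \<union> ?H)"
    using N level[OF g] level[OF h] by (intro emeasure_Un_null_set) auto
  also have "\<dots> \<le> emeasure lebesgue ?G + emeasure lebesgue ?H"
    using level[OF g] level[OF h] by (intro emeasure_subadditive)
  also have "\<dots> \<le> ennreal (a + b)"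
    using s t assms by (simp add: ennreal_plus add_mono)
  finally have "rearr Om f (a + b) \<le> ennreal (s + t)"
    unfolding rearr_def using s t by (intro INF_lower) auto
  then show "rearr Om f (a + b) \<le> ennreal s + ennreal t"
    using s t by simp
qed

lemma rearr_le_weak_Lp_norm:
  assumes "0 < s" "s < 1"
  shows "ennreal (s powr (1 / p)) * rearr Om f s \<le> weak_Lp_norm Om p f"
  unfolding weak_Lp_norm_def using assms by (intro SUP_upper) auto

lemma rearr_powr_le_weak_Lp_norm:
  assumes "0 < s" "s < 1" "0 < p"
  shows "epowr (rearr Om f s) p \<le> ennreal (1 / s) * epowr (weak_Lp_norm Om p f) p"
proof -
  have "epowr (rearr Om f s) p = ennreal (1 / s) * (ennreal s * epowr (rearr Om f s) p)"
    using assms by (simp flip: mult.assoc ennreal_mult)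
  also have "ennreal s * epowr (rearr Om f s) p = epowr (ennreal (s powr (1 / p)) * rearr Om f s) p"
    using assms by (simp add: epowr_mult epowr_ennreal powr_powr)
  also have "\<dots> \<le> epowr (weak_Lp_norm Om p f) p"
    using assms by (intro epowr_mono rearr_le_weak_Lp_norm) auto
  finally show ?thesis
    by (simp add: mult_left_mono)
qed

text \<open>The rearrangement is nonincreasing, so its values on \<open>(0,s)\<close> are at least its value at \<open>s\<close>.\<close>

lemma mult_rearr_powr_le_integral:
  assumes "0 < s" "0 \<le> p"
  shows "ennreal s * epowr (rearr Om f s) p
    \<le> (\<integral>\<^sup>+ \<sigma> \<in> {0<..<s}. epowr (rearr Om f \<sigma>) p \<partial>lborel)"
proof -
  have "ennreal s * epowr (rearr Om f s) p
      = (\<integral>\<^sup>+ \<sigma>. epowr (rearr Om f s) p * indicator {0<..<s} \<sigma> \<partial>lborel)"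
    using assms by (subst nn_integral_cmult_indicator) (auto simp: mult.commute)
  also have "\<dots> \<le> (\<integral>\<^sup>+ \<sigma> \<in> {0<..<s}. epowr (rearr Om f \<sigma>) p \<partial>lborel)"
    using assms by (intro nn_integral_mono) (auto simp: indicator_def intro!: epowr_mono rearr_antimono)
  finally show ?thesis .
qed

section \<open>Control by the weak and the small Lebesgue norm\<close>

text \<open>The antiderivative is \<open>- (1 - ln t)^\<gamma> / \<gamma>\<close>. All logarithmic weights of the proof have this
  form, with \<open>\<gamma> = 1 - 1/p\<close>, \<open>\<gamma> = 1\<close> and \<open>\<gamma> = \<theta> b\<close>.\<close>

lemma nn_integral_log_powr:
  assumes "0 < a" "a \<le> b" "b \<le> 1" "\<gamma> \<noteq> 0"
  shows "(\<integral>\<^sup>+ t \<in> {a..b}. ennreal (1 / t * (1 - ln t) powr (\<gamma> - 1)) \<partial>lborel)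
    = ennreal (((1 - ln a) powr \<gamma> - (1 - ln b) powr \<gamma>) / \<gamma>)"
proof -
  define F where "F t = - ((1 - ln t) powr \<gamma> / \<gamma>)" for t :: real
  have "(\<integral>\<^sup>+ t \<in> {a..b}. ennreal (1 / t * (1 - ln t) powr (\<gamma> - 1)) \<partial>lborel) = F b - F a"
  proof (rule nn_integral_FTC_Icc)
    fix x assume "x \<in> {a..b}"
    then have x: "0 < x" "x \<le> 1"
      using assms by auto
    then have u: "0 < 1 - ln x"
      using ln_le_zero_iff[of x] by linarith
    have "DERIV (\<lambda>t. 1 - ln t) x :> - (1 / x)"
      using x by (auto intro!: derivative_eq_intros)
    then have "DERIV (\<lambda>t. (1 - ln t) powr \<gamma>) x :> \<gamma> * (1 - ln x) powr (\<gamma> - 1) * - (1 / x)"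
      using DERIV_fun_powr[of "\<lambda>t. 1 - ln t" "- (1 / x)" x \<gamma>] u by simp
    from DERIV_minus[OF DERIV_cdivide[OF this, of \<gamma>]]
    have "DERIV F x :> - (\<gamma> * (1 - ln x) powr (\<gamma> - 1) * - (1 / x) / \<gamma>)"
      unfolding F_def .
    then show "DERIV F x :> 1 / x * (1 - ln x) powr (\<gamma> - 1)"
      using assms(4) by simp
    show "0 \<le> 1 / x * (1 - ln x) powr (\<gamma> - 1)"
      using x by simp
  next
    show "(\<lambda>t. 1 / t * (1 - ln t) powr (\<gamma> - 1)) \<in> borel_measurable borel"
      by measurable
  qed (use assms in simp)
  then show ?thesis
    by (simp add: F_def diff_divide_distrib)
qed

text \<open>The function \<open>F(t) = (\<integral>_0^t h_*^p)^(1/p)\<close> is nondecreasing, so the small norm is at least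
  \<open>F(t)\<close> times the mass \<open>(u^b - 1) / b\<close> of its weight on \<open>(t,1)\<close>, with \<open>b = 1 - 1/p\<close>. The mass
  vanishes at \<open>t = 1\<close>; staying below \<open>1/2\<close> makes it comparable to \<open>u^b\<close>.\<close>

lemma small_Lp_norm_controls_integral:
  assumes "1 < p"
  obtains C where "0 < C"
    "\<And>(Om :: (real^'n) set) h t. 0 < t \<Longrightarrow> t \<le> 1 / 2 \<Longrightarrow>
      (\<integral>\<^sup>+ \<sigma> \<in> {0<..<t}. epowr (rearr Om h \<sigma>) p \<partial>lborel)
      \<le> epowr (ennreal (C * (1 - ln t) powr (- (1 - 1 / p))) * small_Lp_norm Om p h) p"
proof
  define b where "b = 1 - 1 / p"
  \<comment> \<open>The value of \<open>(u^b - 1) / (b u^b)\<close> at \<open>u = 1 + ln 2\<close>, that is at \<open>t = 1/2\<close>, where it is least on \<open>(0,1/2]\<close>.\<close>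
  define c where "c = (1 - (1 + ln 2) powr (- b)) / b"
  have b: "0 < b" using assms by (simp add: b_def)
  have "(1 + ln 2 :: real) powr (- b) < 1"
    using b by (intro powr_less_one) auto
  then have c: "0 < c" using b by (simp add: c_def)
  then show "0 < 1 / c" by simp
  fix Om :: "(real^'n) set" and h and t :: real
  assume t: "0 < t" "t \<le> 1 / 2"
  define F where "F \<tau> = epowr (\<integral>\<^sup>+ \<sigma> \<in> {0<..<\<tau>}. epowr (rearr Om h \<sigma>) p \<partial>lborel) (1 / p)" for \<tau>
  define u where "u = 1 - ln t"
  have "ln t \<le> ln (1 / 2)" using t by (subst ln_le_cancel_iff) auto
  then have u: "1 + ln 2 \<le> u" by (simp add: u_def ln_div)
  have u0: "0 < u" using u ln_gt_zero[of "2::real"] by linarith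
  have "c * u powr b \<le> (u powr b - 1) / b"
  proof -
    have "1 = u powr b * u powr (- b)"
      using u0 by (simp flip: powr_add)
    also have "\<dots> \<le> u powr b * (1 + ln 2) powr (- b)"
      using u b by (intro mult_left_mono powr_mono2') (auto intro: add_pos_pos)
    finally have "1 \<le> u powr b * (1 + ln 2) powr (- b)" .
    moreover have "c * b = 1 - (1 + ln 2) powr (- b)"
      using b by (simp add: c_def)
    ultimately have "(c * b) * u powr b \<le> u powr b - 1"
      by (simp only: left_diff_distrib mult_1_left mult.commute[of "u powr b"])
    then show ?thesis using b by (simp add: pos_le_divide_eq mult_ac)
  qed
  then have "ennreal (c * u powr b) * F t \<le> ennreal ((u powr b - 1) / b) * F t"
    by (intro mult_right_mono ennreal_leI) auto
  also have "ennreal ((u powr b - 1) / b)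
      = (\<integral>\<^sup>+ \<tau> \<in> {t..1}. ennreal (1 / \<tau> * (1 - ln \<tau>) powr (b - 1)) \<partial>lborel)"
    using t b by (subst nn_integral_log_powr) (auto simp: u_def)
  also have "\<dots> * F t = (\<integral>\<^sup>+ \<tau> \<in> {t..1}. ennreal (1 / \<tau> * (1 - ln \<tau>) powr (b - 1)) * F t \<partial>lborel)"
    by (subst nn_integral_multc[symmetric]) (auto simp: mult_ac)
  also have "\<dots> \<le> small_Lp_norm Om p h"
    unfolding small_Lp_norm_def F_def[symmetric]
  proof (rule nn_integral_mono_AE)
    \<comment> \<open>The weight is integrated over a closed interval, the norm over an open one.\<close>
    have "AE \<tau> in lborel. \<tau> \<noteq> (1::real)" by (rule AE_lborel_singleton)
    then show "AE \<tau> in lborel. ennreal (1 / \<tau> * (1 - ln \<tau>) powr (b - 1)) * F t * indicator {t..1} \<tau>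
      \<le> ennreal ((1 - ln \<tau>) powr - (1 / p)) * F \<tau> * ennreal (1 / \<tau>) * indicator {0<..<1} \<tau>"
    proof eventually_elim
      case (elim \<tau>)
      show ?case
      proof (cases "\<tau> \<in> {t..1}")
        case True
        then have "F t \<le> F \<tau>" unfolding F_def
          using assms by (intro epowr_mono nn_set_integral_set_mono) auto
        moreover have "ennreal (1 / \<tau> * (1 - ln \<tau>) powr (b - 1))
            = ennreal ((1 - ln \<tau>) powr - (1 / p)) * ennreal (1 / \<tau>)"
          using True t by (subst ennreal_mult[symmetric]) (auto simp: b_def mult.commute)
        ultimately show ?thesis
          using True elim t by (auto simp: mult_ac intro!: mult_right_mono)
      qed auto
    qed
  qed
  finally have le: "ennreal (c * u powr b) * F t \<le> small_Lp_norm Om p h" .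
  have "F t = ennreal (1 / c * u powr (- b)) * (ennreal (c * u powr b) * F t)"
    using c u0 by (simp add: powr_minus field_simps flip: mult.assoc ennreal_mult)
  also have "\<dots> \<le> ennreal (1 / c * u powr (- b)) * small_Lp_norm Om p h"
    using le by (intro mult_left_mono) auto
  finally have "F t \<le> ennreal (1 / c * u powr (- b)) * small_Lp_norm Om p h" .
  then show "(\<integral>\<^sup>+ \<sigma> \<in> {0<..<t}. epowr (rearr Om h \<sigma>) p \<partial>lborel)
      \<le> epowr (ennreal (1 / c * (1 - ln t) powr (- (1 - 1 / p))) * small_Lp_norm Om p h) p"
    unfolding F_def u_def b_def using assms by (intro epowr_le_imp_le) auto
qed

section \<open>Pointwise bounds by the K-functional\<close>

lemma K_fun_greatest:
  assumes "0 < C"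
    and "\<And>g h. (g, h) \<in> decomps Om N0 N1 f \<Longrightarrow> X \<le> ennreal C * (N0 g + ennreal t * N1 h)"
  shows "X \<le> ennreal C * K_fun Om N0 N1 f t"
proof -
  have inv: "ennreal C * ennreal (1 / C) = 1" "ennreal (1 / C) * ennreal C = 1"
    using assms(1) by (simp_all flip: ennreal_mult)
  have "ennreal (1 / C) * X \<le> K_fun Om N0 N1 f t"
    unfolding K_fun_def
  proof (intro INF_greatest, clarify)
    fix g h assume "(g, h) \<in> decomps Om N0 N1 f"
    from mult_left_mono[OF assms(2)[OF this], of "ennreal (1 / C)"]
    show "ennreal (1 / C) * X \<le> N0 g + ennreal t * N1 h"
      by (simp add: inv flip: mult.assoc)
  qed
  from mult_left_mono[OF this, of "ennreal C"] show ?thesis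
    by (simp add: inv flip: mult.assoc)
qed

lemma mono_K_fun: "mono (K_fun Om N0 N1 f)"
  unfolding K_fun_def
  by (intro monoI INF_mono') (auto intro!: add_left_mono mult_right_mono ennreal_leI)

lemma K_fun_measurable [measurable]: "K_fun Om N0 N1 f \<in> borel_measurable borel"
  by (rule borel_measurable_mono_ennreal[OF mono_K_fun])

lemma K_fun_div_antimono:
  assumes "0 < s" "s \<le> t"
  shows "ennreal (1 / t) * K_fun Om N0 N1 f t \<le> ennreal (1 / s) * K_fun Om N0 N1 f s"
proof (rule K_fun_greatest)
  fix g h assume gh: "(g, h) \<in> decomps Om N0 N1 f"
  have "K_fun Om N0 N1 f t \<le> N0 g + ennreal t * N1 h"
    unfolding K_fun_def using gh by (auto intro: INF_lower2)
  then have "ennreal (1 / t) * K_fun Om N0 N1 f t \<le> ennreal (1 / t) * (N0 g + ennreal t * N1 h)"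
    by (rule mult_left_mono) simp
  also have "\<dots> = ennreal (1 / t) * N0 g + N1 h"
    using assms by (simp add: distrib_left flip: mult.assoc ennreal_mult)
  also have "\<dots> \<le> ennreal (1 / s) * N0 g + N1 h"
    using assms by (intro add_right_mono mult_right_mono ennreal_leI) (auto intro!: divide_left_mono)
  also have "\<dots> = ennreal (1 / s) * (N0 g + ennreal s * N1 h)"
    using assms by (simp add: distrib_left flip: mult.assoc ennreal_mult)
  finally show "ennreal (1 / t) * K_fun Om N0 N1 f t \<le> \<dots>" .
qed (use assms in simp)

lemma rearr_sum_le:
  fixes Om :: "(real^'n) set"
  assumes "Om \<in> sets lebesgue" "(g, h) \<in> decomps Om N0 N1 f" "0 < s"
  shows "rearr Om f s \<le> rearr Om g (s / 2) + rearr Om h (s / 2)"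
  using rearr_add[of Om g h f "s / 2" "s / 2"] assms
  by (simp add: decomps_def norm_space_def)

text \<open>For \<open>f = g + h\<close>, the value \<open>(s/2)^(1/p) g_*(s/2)\<close> is bounded by the weak norm of \<open>g\<close>, while
  \<open>(s/2)^(1/p) h_*(s/2)\<close> is bounded by \<open>(\<integral>_0^(s/2) h_*^p)^(1/p)\<close>, hence by the small norm of \<open>h\<close> with
  the factor \<open>u^(-(1-1/p))\<close>. The latter bound applies for every \<open>s < 1\<close> because \<open>s/2 < 1/2\<close>.\<close>

lemma sup_rearr_le_K_fun:
  assumes "1 < p"
  obtains C where "0 < C"
    "\<And>(Om :: (real^'n) set) f t. Om \<in> sets lebesgue \<Longrightarrow> 0 < t \<Longrightarrow> t < 1 \<Longrightarrow>
      (SUP s \<in> {0<..<t}. ennreal (s powr (1 / p)) * rearr Om f s)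
      \<le> ennreal C * K_fun Om (weak_Lp_norm Om p) (small_Lp_norm Om p) f
          ((1 - ln t) powr (- (1 - 1 / p)))"
proof -
  obtain C where C: "0 < C"
    "\<And>(Om :: (real^'n) set) h t. 0 < t \<Longrightarrow> t \<le> 1 / 2 \<Longrightarrow>
      (\<integral>\<^sup>+ \<sigma> \<in> {0<..<t}. epowr (rearr Om h \<sigma>) p \<partial>lborel)
      \<le> epowr (ennreal (C * (1 - ln t) powr (- (1 - 1 / p))) * small_Lp_norm Om p h) p"
    by (rule small_Lp_norm_controls_integral[OF assms, where 'n = 'n]) (rule that)
  show thesis
  proof (rule that[of "2 powr (1 / p) * (1 + C)"])
    show "0 < 2 powr (1 / p) * (1 + C)" using C(1) by simp
    fix Om :: "(real^'n) set" and f and t :: real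
    assume Om: "Om \<in> sets lebesgue" and t: "0 < t" "t < 1"
    define v where "v = (1 - ln t) powr (- (1 - 1 / p))"
    show "(SUP s \<in> {0<..<t}. ennreal (s powr (1 / p)) * rearr Om f s)
      \<le> ennreal (2 powr (1 / p) * (1 + C)) * K_fun Om (weak_Lp_norm Om p) (small_Lp_norm Om p) f
          ((1 - ln t) powr (- (1 - 1 / p)))"
      unfolding v_def[symmetric]
    proof (intro SUP_least K_fun_greatest)
      fix s g h assume s: "s \<in> {0<..<t}"
        and gh: "(g, h) \<in> decomps Om (weak_Lp_norm Om p) (small_Lp_norm Om p) f"
      let ?A = "weak_Lp_norm Om p g" and ?B = "small_Lp_norm Om p h"
      have g: "ennreal ((s / 2) powr (1 / p)) * rearr Om g (s / 2) \<le> ?A"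
        using s t by (intro rearr_le_weak_Lp_norm) auto
      have "ennreal (s / 2) * epowr (rearr Om h (s / 2)) p
          \<le> epowr (ennreal (C * (1 - ln (s / 2)) powr (- (1 - 1 / p))) * ?B) p"
        using s t assms
        by (intro order_trans[OF mult_rearr_powr_le_integral C(2)]) auto
      from epowr_mono[OF this, of "1 / p"]
      have "ennreal ((s / 2) powr (1 / p)) * rearr Om h (s / 2)
          \<le> ennreal (C * (1 - ln (s / 2)) powr (- (1 - 1 / p))) * ?B"
        using s assms by (simp add: epowr_mult epowr_ennreal epowr_inverse_cancel)
      also have "\<dots> \<le> ennreal (C * v) * ?B"
      proof -
        have "ln (s / 2) \<le> ln t" "ln t < 0" using s t by auto
        then have "(1 - ln (s / 2)) powr (- (1 - 1 / p)) \<le> v"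
          unfolding v_def using assms by (intro powr_mono2') auto
        then show ?thesis
          using C(1) by (intro mult_right_mono ennreal_leI mult_left_mono) auto
      qed
      finally have h: "ennreal ((s / 2) powr (1 / p)) * rearr Om h (s / 2) \<le> ennreal (C * v) * ?B" .
      have v: "0 \<le> v" by (simp add: v_def)
      have "ennreal (s powr (1 / p)) * rearr Om f s
          \<le> ennreal (s powr (1 / p)) * (rearr Om g (s / 2) + rearr Om h (s / 2))"
        using rearr_sum_le[OF Om gh] s by (intro mult_left_mono) auto
      also have "\<dots> = ennreal (2 powr (1 / p)) * (ennreal ((s / 2) powr (1 / p)) * rearr Om g (s / 2)
             + ennreal ((s / 2) powr (1 / p)) * rearr Om h (s / 2))"
      proof -
        have "s powr (1 / p) = 2 powr (1 / p) * (s / 2) powr (1 / p)"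
          using s by (simp flip: powr_mult)
        then have "ennreal (s powr (1 / p)) = ennreal (2 powr (1 / p)) * ennreal ((s / 2) powr (1 / p))"
          by (simp only:) (intro ennreal_mult, auto)
        then show ?thesis by (simp only: distrib_left mult_ac)
      qed
      also have "\<dots> \<le> ennreal (2 powr (1 / p)) * (ennreal (1 + C) * ?A + ennreal (1 + C) * (ennreal v * ?B))"
      proof (intro mult_left_mono add_mono)
        have "1 * ?A \<le> ennreal (1 + C) * ?A"
          using C(1) by (intro mult_right_mono) auto
        then show "ennreal ((s / 2) powr (1 / p)) * rearr Om g (s / 2) \<le> ennreal (1 + C) * ?A"
          using g by simp
        have "ennreal (C * v) * ?B \<le> ennreal ((1 + C) * v) * ?B"
          using v by (intro mult_right_mono ennreal_leI) auto
        then show "ennreal ((s / 2) powr (1 / p)) * rearr Om h (s / 2)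
            \<le> ennreal (1 + C) * (ennreal v * ?B)"
          using h C(1) v by (simp add: ennreal_mult mult.assoc)
      qed auto
      also have "\<dots> = ennreal (2 powr (1 / p) * (1 + C)) * (?A + ennreal v * ?B)"
      proof -
        have "ennreal (2 powr (1 / p) * (1 + C)) = ennreal (2 powr (1 / p)) * ennreal (1 + C)"
          using C(1) by (intro ennreal_mult) auto
        then show ?thesis by (simp only: distrib_left mult_ac)
      qed
      finally show "ennreal (s powr (1 / p)) * rearr Om f s \<le> \<dots>" .
    qed (use C(1) in simp)
  qed
qed

lemma nn_integral_half_arg:
  fixes \<phi> :: "real \<Rightarrow> ennreal"
  assumes [measurable]: "\<phi> \<in> borel_measurable borel"
  shows "(\<integral>\<^sup>+ \<sigma> \<in> {0<..<t}. \<phi> (\<sigma> / 2) \<partial>lborel) = 2 * (\<integral>\<^sup>+ \<sigma> \<in> {0<..<t / 2}. \<phi> \<sigma> \<partial>lborel)"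
proof -
  have "(\<integral>\<^sup>+ \<sigma> \<in> {0<..<t / 2}. \<phi> \<sigma> \<partial>lborel)
      = ennreal (1 / 2) * (\<integral>\<^sup>+ \<sigma>. \<phi> (\<sigma> / 2) * indicator {0<..<t / 2} (\<sigma> / 2) \<partial>lborel)"
    by (subst nn_integral_real_affine[where c = "1 / 2" and t = 0]) auto
  also have "(\<lambda>\<sigma>. indicator {0<..<t / 2} (\<sigma> / 2) :: ennreal) = indicator {0<..<t}"
    by (auto simp: indicator_def)
  finally have "2 * (\<integral>\<^sup>+ \<sigma> \<in> {0<..<t / 2}. \<phi> \<sigma> \<partial>lborel)
      = (2 * ennreal (1 / 2)) * (\<integral>\<^sup>+ \<sigma> \<in> {0<..<t}. \<phi> (\<sigma> / 2) \<partial>lborel)"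
    by (simp only: mult.assoc)
  also have "2 * ennreal (1 / 2) = 1"
    using ennreal_mult[of 2 "1 / 2"] by simp
  finally show ?thesis by simp
qed

text \<open>The left end point of the block is chosen so that \<open>1 - ln \<sigma>\<close> equals \<open>2 u\<close> there; hence the
  weight is at most \<open>1/u\<close> on the block, and \<open>\<integral> d\<sigma>/\<sigma>\<close> over the block is \<open>u\<close>. The two cancel in
  the contribution of \<open>g\<close>, which is thus a constant times the \<open>p\<close>-th power of the weak norm. In the
  contribution of \<open>h\<close> the factor \<open>1/u = (u^(-1/p))^p\<close> improves \<open>u^(-(1-1/p))\<close> to \<open>u^(-1)\<close>, so the
  K-functional appears at \<open>1/u\<close>.\<close>

lemma block_le_K_fun:
  assumes "1 < p"
  obtains C where "0 < C"
    "\<And>(Om :: (real^'n) set) f t. Om \<in> sets lebesgue \<Longrightarrow> 0 < t \<Longrightarrow> t < 1 \<Longrightarrow>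
      (\<integral>\<^sup>+ \<sigma> \<in> {exp (1 - 2 * (1 - ln t))..<t}.
        epowr (rearr Om f \<sigma>) p * ennreal ((1 - ln \<sigma>) powr (- 1)) \<partial>lborel)
      \<le> epowr (ennreal C * K_fun Om (weak_Lp_norm Om p) (small_Lp_norm Om p) f (1 / (1 - ln t))) p"
proof -
  obtain C where C: "0 < C"
    "\<And>(Om :: (real^'n) set) h t. 0 < t \<Longrightarrow> t \<le> 1 / 2 \<Longrightarrow>
      (\<integral>\<^sup>+ \<sigma> \<in> {0<..<t}. epowr (rearr Om h \<sigma>) p \<partial>lborel)
      \<le> epowr (ennreal (C * (1 - ln t) powr (- (1 - 1 / p))) * small_Lp_norm Om p h) p"
    by (rule small_Lp_norm_controls_integral[OF assms, where 'n = 'n]) (rule that)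
  \<comment> \<open>The factor \<open>2^p\<close> comes from \<open>(x + y)^p \<le> 2^p (x^p + y^p)\<close>, the other \<open>2\<close> from \<open>\<sigma>/2\<close>.\<close>
  define D where "D = (2 powr p * 2) powr (1 / p) * (1 + C)"
  show thesis
  proof (rule that[of D])
    show D: "0 < D" using C(1) by (simp add: D_def)
    fix Om :: "(real^'n) set" and f and t :: real
    assume Om: "Om \<in> sets lebesgue" and t: "0 < t" "t < 1"
    define u where "u = 1 - ln t"
    define a where "a = exp (1 - 2 * u)"
    have u: "1 < u" using t by (simp add: u_def)
    have "1 - 2 * u < ln t" using u by (simp add: u_def)
    then have a: "0 < a" "a < t"
      unfolding a_def using t exp_less_cancel_iff[of _ "ln t"] by simp_all
    let ?X = "\<integral>\<^sup>+ \<sigma> \<in> {a..<t}. epowr (rearr Om f \<sigma>) p * ennreal ((1 - ln \<sigma>) powr (- 1)) \<partial>lborel"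
    have "epowr ?X (1 / p) \<le> ennreal D * K_fun Om (weak_Lp_norm Om p) (small_Lp_norm Om p) f (1 / u)"
    proof (rule K_fun_greatest)
      fix g h
      assume gh: "(g, h) \<in> decomps Om (weak_Lp_norm Om p) (small_Lp_norm Om p) f"
      let ?A = "weak_Lp_norm Om p g" and ?B = "small_Lp_norm Om p h"
      \<comment> \<open>The vanishing exponent below makes the integrand \<open>1 / \<sigma>\<close> an instance of the log-power integral.\<close>
      have int_g: "(\<integral>\<^sup>+ \<sigma> \<in> {a..<t}. epowr (rearr Om g (\<sigma> / 2)) p \<partial>lborel)
          \<le> ennreal (2 * u) * epowr ?A p"
      proof -
        have "(\<integral>\<^sup>+ \<sigma> \<in> {a..<t}. epowr (rearr Om g (\<sigma> / 2)) p \<partial>lborel)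
          \<le> (\<integral>\<^sup>+ \<sigma>. 2 * epowr ?A p * (ennreal (1 / \<sigma> * (1 - ln \<sigma>) powr (1 - 1)) * indicator {a..t} \<sigma>) \<partial>lborel)"
        proof (rule nn_integral_mono)
          fix \<sigma> :: real
          show "epowr (rearr Om g (\<sigma> / 2)) p * indicator {a..<t} \<sigma>
            \<le> 2 * epowr ?A p * (ennreal (1 / \<sigma> * (1 - ln \<sigma>) powr (1 - 1)) * indicator {a..t} \<sigma>)"
          proof (cases "\<sigma> \<in> {a..<t}")
            case True
            then have \<sigma>: "0 < \<sigma>" "\<sigma> < 1" using a t by auto
            then have "ln \<sigma> < 0" by simp
            then have one: "(1 - ln \<sigma>) powr (1 - 1) = 1" by simp
            have "epowr (rearr Om g (\<sigma> / 2)) p \<le> ennreal (1 / (\<sigma> / 2)) * epowr ?A p"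
              using \<sigma> assms by (intro rearr_powr_le_weak_Lp_norm) auto
            also have "ennreal (1 / (\<sigma> / 2)) = 2 * ennreal (1 / \<sigma>)"
              using \<sigma> ennreal_mult[of 2 "1 / \<sigma>"] by simp
            finally show ?thesis
              using True unfolding one by (simp add: mult_ac)
          qed auto
        qed
        also have "\<dots> = 2 * epowr ?A p * ennreal u"
        proof (subst nn_integral_cmult)
          have "(\<integral>\<^sup>+ \<sigma> \<in> {a..t}. ennreal (1 / \<sigma> * (1 - ln \<sigma>) powr (1 - 1)) \<partial>lborel) = ennreal u"
          proof -
            have "1 - ln a = 2 * u" "1 - ln t = u" by (simp_all add: a_def u_def)
            then show ?thesis
              using nn_integral_log_powr[of a t 1] a t u by simp
          qed
          then show "2 * epowr ?A p * (\<integral>\<^sup>+ \<sigma> \<in> {a..t}. ennreal (1 / \<sigma> * (1 - ln \<sigma>) powr (1 - 1)) \<partial>lborel)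
             = 2 * epowr ?A p * ennreal u"
            by simp
        qed measurable
        also have "\<dots> = ennreal (2 * u) * epowr ?A p"
          using u by (simp add: ennreal_mult mult_ac)
        finally show ?thesis .
      qed
      have int_h: "(\<integral>\<^sup>+ \<sigma> \<in> {a..<t}. epowr (rearr Om h (\<sigma> / 2)) p \<partial>lborel)
          \<le> 2 * epowr (ennreal (C * u powr (- (1 - 1 / p))) * ?B) p"
      proof -
        have "(\<integral>\<^sup>+ \<sigma> \<in> {a..<t}. epowr (rearr Om h (\<sigma> / 2)) p \<partial>lborel)
            \<le> (\<integral>\<^sup>+ \<sigma> \<in> {0<..<t}. epowr (rearr Om h (\<sigma> / 2)) p \<partial>lborel)"
          using a by (intro nn_set_integral_set_mono) auto
        also have "\<dots> = 2 * (\<integral>\<^sup>+ \<sigma> \<in> {0<..<t / 2}. epowr (rearr Om h \<sigma>) p \<partial>lborel)"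
          by (intro nn_integral_half_arg) measurable
        also have "\<dots> \<le> 2 * epowr (ennreal (C * (1 - ln (t / 2)) powr (- (1 - 1 / p))) * ?B) p"
          using t by (intro mult_left_mono C(2)) auto
        also have "\<dots> \<le> 2 * epowr (ennreal (C * u powr (- (1 - 1 / p))) * ?B) p"
        proof -
          have "u \<le> 1 - ln (t / 2)" using t by (simp add: u_def)
          then have "(1 - ln (t / 2)) powr (- (1 - 1 / p)) \<le> u powr (- (1 - 1 / p))"
            using assms u by (intro powr_mono2') auto
          then show ?thesis
            using C(1) assms by (intro mult_left_mono epowr_mono mult_right_mono ennreal_leI) auto
        qed
        finally show ?thesis .
      qed
      have "?X \<le> (\<integral>\<^sup>+ \<sigma>. ennreal (2 powr p / u)
          * (epowr (rearr Om g (\<sigma> / 2)) p * indicator {a..<t} \<sigma>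
             + epowr (rearr Om h (\<sigma> / 2)) p * indicator {a..<t} \<sigma>) \<partial>lborel)"
      proof (rule nn_integral_mono)
        fix \<sigma> :: real
        show "epowr (rearr Om f \<sigma>) p * ennreal ((1 - ln \<sigma>) powr (- 1)) * indicator {a..<t} \<sigma>
          \<le> ennreal (2 powr p / u)
          * (epowr (rearr Om g (\<sigma> / 2)) p * indicator {a..<t} \<sigma>
             + epowr (rearr Om h (\<sigma> / 2)) p * indicator {a..<t} \<sigma>)"
        proof (cases "\<sigma> \<in> {a..<t}")
          case True
          then have \<sigma>: "0 < \<sigma>" "\<sigma> < t" using a t by auto
          then have "u \<le> 1 - ln \<sigma>" using t by (simp add: u_def)
          then have w: "(1 - ln \<sigma>) powr (- 1) \<le> 1 / u"
            using u by (simp add: powr_minus_divide frac_le)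
          have "epowr (rearr Om f \<sigma>) p \<le> epowr (rearr Om g (\<sigma> / 2) + rearr Om h (\<sigma> / 2)) p"
            using rearr_sum_le[OF Om gh] \<sigma> assms by (intro epowr_mono) auto
          also have "\<dots> \<le> ennreal (2 powr p) * (epowr (rearr Om g (\<sigma> / 2)) p + epowr (rearr Om h (\<sigma> / 2)) p)"
            using assms by (intro epowr_add_le) auto
          finally have "epowr (rearr Om f \<sigma>) p * ennreal ((1 - ln \<sigma>) powr (- 1))
            \<le> ennreal (2 powr p) * (epowr (rearr Om g (\<sigma> / 2)) p + epowr (rearr Om h (\<sigma> / 2)) p) * ennreal (1 / u)"
            using w by (intro mult_mono ennreal_leI) auto
          also have "\<dots> = ennreal (2 powr p / u) * (epowr (rearr Om g (\<sigma> / 2)) p + epowr (rearr Om h (\<sigma> / 2)) p)"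
          proof -
            have "ennreal (2 powr p / u) = ennreal (2 powr p) * ennreal (1 / u)"
              using u by (subst ennreal_mult[symmetric]) auto
            then show ?thesis by (simp only: mult_ac)
          qed
          finally show ?thesis using True by simp
        qed auto
      qed
      also have "\<dots> = ennreal (2 powr p / u)
          * ((\<integral>\<^sup>+ \<sigma> \<in> {a..<t}. epowr (rearr Om g (\<sigma> / 2)) p \<partial>lborel)
             + (\<integral>\<^sup>+ \<sigma> \<in> {a..<t}. epowr (rearr Om h (\<sigma> / 2)) p \<partial>lborel))"
        by (subst nn_integral_cmult, measurable) (subst nn_integral_add, measurable)
      also have "\<dots> \<le> ennreal (2 powr p / u) * (ennreal (2 * u) * epowr ?A p
          + 2 * epowr (ennreal (C * u powr (- (1 - 1 / p))) * ?B) p)"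
        by (intro mult_left_mono add_mono int_g int_h) auto
      also have "\<dots> = ennreal (2 powr p * 2) * (epowr ?A p + epowr (ennreal (C / u) * ?B) p)"
      proof -
        have "u powr (- 1) = u powr (- (1 - 1 / p)) * u powr (- (1 / p))"
          by (simp flip: powr_add)
        then have inv: "1 / u = u powr (- (1 - 1 / p)) * u powr (- (1 / p))"
          using u by (simp add: powr_minus_divide)
        have "C / u = C * (1 / u)" by simp
        then have "C / u = (C * u powr (- (1 - 1 / p))) * u powr (- (1 / p))"
          unfolding inv by (simp only: mult.assoc)
        then have eq: "ennreal (C / u) * ?B = ennreal (u powr (- (1 / p))) * (ennreal (C * u powr (- (1 - 1 / p))) * ?B)"
          using C(1) u by (simp add: ennreal_mult mult_ac)
        have "(u powr (- (1 / p))) powr p = u powr (- 1)"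
          unfolding powr_powr using assms by simp
        then have "(u powr (- (1 / p))) powr p = 1 / u"
          using u by (simp add: powr_minus_divide)
        then have B: "epowr (ennreal (C / u) * ?B) p
            = ennreal (1 / u) * epowr (ennreal (C * u powr (- (1 - 1 / p))) * ?B) p"
          unfolding eq epowr_mult[of "ennreal (u powr (- (1 / p)))"]
          by (simp only: epowr_ennreal[OF powr_ge_zero])
        have c: "ennreal (2 powr p / u) * ennreal (2 * u) = ennreal (2 powr p * 2)"
          "ennreal (2 powr p / u) * 2 = ennreal (2 powr p * 2) * ennreal (1 / u)"
          using u ennreal_mult[of "2 powr p / u" 2] by (simp_all flip: ennreal_mult)
        show ?thesis
          by (simp only: B distrib_left c flip: mult.assoc)
      qed
      also have "\<dots> \<le> ennreal (2 powr p * 2) * epowr (ennreal (1 + C) * (?A + ennreal (1 / u) * ?B)) p"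
      proof (intro mult_left_mono)
        have "1 * ?A \<le> ennreal (1 + C) * ?A"
          using C(1) by (intro mult_right_mono) auto
        moreover have "ennreal (C / u) * ?B \<le> ennreal (1 + C) * (ennreal (1 / u) * ?B)"
        proof -
          have "ennreal (C / u) \<le> ennreal ((1 + C) * (1 / u))"
            using u by (intro ennreal_leI) (simp add: divide_right_mono)
          also have "\<dots> = ennreal (1 + C) * ennreal (1 / u)"
            using u C(1) by (intro ennreal_mult) auto
          finally show ?thesis
            unfolding mult.assoc[symmetric] by (intro mult_right_mono) auto
        qed
        ultimately have le: "?A + ennreal (C / u) * ?B \<le> ennreal (1 + C) * (?A + ennreal (1 / u) * ?B)"
          unfolding distrib_left by (intro add_mono) simp_all
        have "epowr ?A p + epowr (ennreal (C / u) * ?B) p \<le> epowr (?A + ennreal (C / u) * ?B) p"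
          using assms by (intro epowr_superadditive) auto
        also have "\<dots> \<le> epowr (ennreal (1 + C) * (?A + ennreal (1 / u) * ?B)) p"
          using le assms by (intro epowr_mono) auto
        finally show "epowr ?A p + epowr (ennreal (C / u) * ?B) p \<le> \<dots>" .
      qed auto
      also have "\<dots> = epowr (ennreal D * (?A + ennreal (1 / u) * ?B)) p"
      proof -
        have "ennreal D * (?A + ennreal (1 / u) * ?B)
          = ennreal ((2 powr p * 2) powr (1 / p)) * (ennreal (1 + C) * (?A + ennreal (1 / u) * ?B))"
          using C(1) by (simp add: D_def ennreal_mult mult.assoc)
        then show ?thesis
          using assms
          by (simp only: epowr_mult[of "ennreal ((2 powr p * 2) powr (1 / p))"])
            (simp add: epowr_ennreal powr_powr)
      qed
      finally have "epowr ?X (1 / p) \<le> epowr (epowr (ennreal D * (?A + ennreal (1 / u) * ?B)) p) (1 / p)"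
        using assms by (intro epowr_mono) auto
      then show "epowr ?X (1 / p) \<le> ennreal D * (?A + ennreal (1 / u) * ?B)"
        using assms by (simp add: epowr_inverse_cancel)
    qed (rule D)
    then show "(\<integral>\<^sup>+ \<sigma> \<in> {exp (1 - 2 * (1 - ln t))..<t}.
        epowr (rearr Om f \<sigma>) p * ennreal ((1 - ln \<sigma>) powr (- 1)) \<partial>lborel)
      \<le> epowr (ennreal D * K_fun Om (weak_Lp_norm Om p) (small_Lp_norm Om p) f (1 / (1 - ln t))) p"
      unfolding a_def u_def using assms by (intro epowr_le_imp_le) auto
  qed
qed

section \<open>Hardy integrals\<close>

definition hardy_integral :: "(real \<Rightarrow> ennreal) \<Rightarrow> real \<Rightarrow> ennreal" where
  "hardy_integral K t = (\<integral>\<^sup>+ s \<in> {0<..<t}. K s * ennreal (1 / s) \<partial>lborel)"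

lemma hardy_integral_measurable [measurable]: "hardy_integral K \<in> borel_measurable borel"
proof (rule borel_measurable_mono_ennreal, rule monoI)
  fix x y :: real
  assume "x \<le> y"
  then show "hardy_integral K x \<le> hardy_integral K y"
    unfolding hardy_integral_def by (intro nn_set_integral_set_mono) auto
qed

lemma hardy_integral_halve:
  assumes [measurable]: "K \<in> borel_measurable borel" and "0 < t"
  shows "hardy_integral K t = hardy_integral K (t / 2)
    + (\<integral>\<^sup>+ s \<in> {t / 2..<t}. K s * ennreal (1 / s) \<partial>lborel)"
proof -
  have "{0<..<t} = {0<..<t / 2} \<union> {t / 2..<t}" using assms by auto
  then show ?thesis
    unfolding hardy_integral_def
    by (simp only:) (intro nn_integral_disjoint_pair, auto)
qed

text \<open>Monotonicity of \<open>K(s)/s\<close> replaces the integrand by the constant \<open>K(t)/t\<close> on an interval of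
  length \<open>t/2\<close>.\<close>

lemma le_integral_dyadic:
  assumes "0 < t"
    and "\<And>s. 0 < s \<Longrightarrow> s \<le> t \<Longrightarrow> ennreal (1 / t) * K t \<le> ennreal (1 / s) * K s"
  shows "K t \<le> 2 * (\<integral>\<^sup>+ s \<in> {t / 2..<t}. K s * ennreal (1 / s) \<partial>lborel)"
proof -
  have "K t = 2 * (ennreal (1 / t) * K t * ennreal (t / 2))"
  proof -
    have "ennreal 2 * ennreal (1 / t) * ennreal (t / 2) = 1"
      using assms(1) by (simp del: ennreal_numeral flip: ennreal_mult)
    then have "K t = (ennreal 2 * ennreal (1 / t) * ennreal (t / 2)) * K t" by simp
    then show ?thesis by (simp add: mult_ac)
  qed
  also have "ennreal (1 / t) * K t * ennreal (t / 2)
      = (\<integral>\<^sup>+ s. ennreal (1 / t) * K t * indicator {t / 2..<t} s \<partial>lborel)"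
    using assms(1) by (subst nn_integral_cmult_indicator) auto
  also have "\<dots> \<le> (\<integral>\<^sup>+ s \<in> {t / 2..<t}. K s * ennreal (1 / s) \<partial>lborel)"
    using assms by (intro nn_integral_mono) (auto simp: indicator_def mult.commute)
  finally show ?thesis by (simp add: mult_left_mono)
qed

text \<open>Doubling \<open>u = 1 - ln t\<close> halves \<open>1/u\<close>. So the block that ends at \<open>t\<close> is paid for by the part of
  the Hardy integral between \<open>1/(2u)\<close> and \<open>1/u\<close>, and the next block by the next dyadic part. By
  induction on their number, finitely many blocks are bounded uniformly; together they exhaust
  \<open>(0,t)\<close>.\<close>

lemma integral_le_hardy_integral_of_blocks:
  fixes \<Phi> K :: "real \<Rightarrow> ennreal"
  assumes [measurable]: "\<Phi> \<in> borel_measurable borel" "K \<in> borel_measurable borel"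
    and K: "\<And>s t. 0 < s \<Longrightarrow> s \<le> t \<Longrightarrow> ennreal (1 / t) * K t \<le> ennreal (1 / s) * K s"
    and block: "\<And>t. 0 < t \<Longrightarrow> t < 1 \<Longrightarrow>
      (\<integral>\<^sup>+ \<sigma> \<in> {exp (1 - 2 * (1 - ln t))..<t}. \<Phi> \<sigma> \<partial>lborel)
      \<le> epowr (ennreal C * K (1 / (1 - ln t))) p"
    and "1 \<le> p" "0 < t" "t < 1"
  shows "(\<integral>\<^sup>+ \<sigma> \<in> {0<..<t}. \<Phi> \<sigma> \<partial>lborel)
      \<le> epowr (ennreal C * 2 * hardy_integral K (1 / (1 - ln t))) p"
proof -
  \<comment> \<open>The left end of the \<open>n\<close>-th block below \<open>t\<close>: there \<open>1 - ln \<sigma>\<close> has grown by the factor \<open>2^n\<close>.\<close>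
  define \<tau> where "\<tau> n t = exp (1 - 2 ^ n * (1 - ln t))" for n :: nat and t :: real
  have finite_blocks: "(\<integral>\<^sup>+ \<sigma> \<in> {\<tau> n t..<t}. \<Phi> \<sigma> \<partial>lborel)
      \<le> epowr (ennreal C * 2 * hardy_integral K (1 / (1 - ln t))) p"
    if "0 < t" "t < 1" for n t
    using that
  proof (induction n arbitrary: t)
    case 0
    then have "{\<tau> 0 t..<t} = {}" by (simp add: \<tau>_def)
    then show ?case by simp
  next
    case (Suc n)
    define t' where "t' = \<tau> 1 t"
    define u where "u = 1 - ln t"
    have u: "1 < u" using ln_less_zero[OF Suc.prems] by (simp add: u_def)
    have t'_eq: "t' = exp (1 - 2 * u)" by (simp add: t'_def \<tau>_def u_def)
    have u': "1 - ln t' = 2 * u" by (simp add: t'_eq)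
    have "1 - 2 * u < ln t" using u by (simp add: u_def)
    then have t': "0 < t'" "t' < t"
      unfolding t'_eq using Suc.prems exp_less_cancel_iff[of _ "ln t"] by simp_all
    have \<tau>: "\<tau> (Suc n) t = \<tau> n t'"
      by (simp add: \<tau>_def u' u_def)
    have "2 ^ n * (2 * u) \<ge> 1 * (2 * u)"
      using u by (intro mult_right_mono) auto
    then have "\<tau> n t' \<le> t'" unfolding \<tau>_def u' t'_eq by simp
    then have "{\<tau> (Suc n) t..<t} = {\<tau> n t'..<t'} \<union> {t'..<t}"
      using t' \<tau> by auto
    then have "(\<integral>\<^sup>+ \<sigma> \<in> {\<tau> (Suc n) t..<t}. \<Phi> \<sigma> \<partial>lborel)
        = (\<integral>\<^sup>+ \<sigma> \<in> {\<tau> n t'..<t'}. \<Phi> \<sigma> \<partial>lborel) + (\<integral>\<^sup>+ \<sigma> \<in> {t'..<t}. \<Phi> \<sigma> \<partial>lborel)"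
      by (simp only:) (intro nn_integral_disjoint_pair, auto)
    also have "\<dots> \<le> epowr (ennreal C * 2 * hardy_integral K (1 / (2 * u))) p
        + epowr (ennreal C * K (1 / u)) p"
    proof (rule add_mono)
      show "(\<integral>\<^sup>+ \<sigma> \<in> {\<tau> n t'..<t'}. \<Phi> \<sigma> \<partial>lborel)
          \<le> epowr (ennreal C * 2 * hardy_integral K (1 / (2 * u))) p"
        using Suc.IH[of t'] Suc.prems t' unfolding u' by simp
      show "(\<integral>\<^sup>+ \<sigma> \<in> {t'..<t}. \<Phi> \<sigma> \<partial>lborel) \<le> epowr (ennreal C * K (1 / u)) p"
        using block[OF Suc.prems] unfolding t'_eq u_def .
    qed
    also have "\<dots> \<le> epowr (ennreal C * 2 * hardy_integral K (1 / (2 * u)) + ennreal C * K (1 / u)) p"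
      using assms by (intro epowr_superadditive)
    also have "\<dots> \<le> epowr (ennreal C * 2 * hardy_integral K (1 / u)) p"
    proof (intro epowr_mono)
      have "K (1 / u) \<le> 2 * (\<integral>\<^sup>+ s \<in> {(1 / u) / 2..<1 / u}. K s * ennreal (1 / s) \<partial>lborel)"
        using u by (intro le_integral_dyadic K) auto
      then have "ennreal C * 2 * hardy_integral K ((1 / u) / 2) + ennreal C * K (1 / u)
        \<le> ennreal C * 2 * hardy_integral K ((1 / u) / 2) + ennreal C *
            (2 * (\<integral>\<^sup>+ s \<in> {(1 / u) / 2..<1 / u}. K s * ennreal (1 / s) \<partial>lborel))"
        by (intro add_left_mono mult_left_mono) auto
      also have "\<dots> = ennreal C * 2 * hardy_integral K (1 / u)"
        using u by (subst (2) hardy_integral_halve) (auto simp: distrib_left mult.assoc)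
      finally show "ennreal C * 2 * hardy_integral K (1 / (2 * u)) + ennreal C * K (1 / u)
          \<le> ennreal C * 2 * hardy_integral K (1 / u)"
        by (simp add: mult.commute)
    qed (use assms in simp)
    finally show ?case by (simp add: u_def)
  qed
  have u: "1 < 1 - ln t" using ln_less_zero assms by simp
  have "(\<integral>\<^sup>+ \<sigma> \<in> {0<..<t}. \<Phi> \<sigma> \<partial>lborel)
      = (\<integral>\<^sup>+ \<sigma>. (SUP n. \<Phi> \<sigma> * indicator {\<tau> n t..<t} \<sigma>) \<partial>lborel)"
  proof (rule nn_integral_cong)
    fix \<sigma> :: real
    show "\<Phi> \<sigma> * indicator {0<..<t} \<sigma> = (SUP n. \<Phi> \<sigma> * indicator {\<tau> n t..<t} \<sigma>)"
    proof (cases "\<sigma> \<in> {0<..<t}")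
      case True
      obtain n :: nat where "1 - ln \<sigma> < real n"
        using reals_Archimedean2 by blast
      also have "real n \<le> 2 ^ n" by (rule of_nat_less_two_power[THEN less_imp_le])
      also have "2 ^ n \<le> 2 ^ n * (1 - ln t)" using u by simp
      finally have "1 - 2 ^ n * (1 - ln t) < ln \<sigma>" by simp
      then have "\<tau> n t < \<sigma>"
        unfolding \<tau>_def using True exp_less_cancel_iff[of _ "ln \<sigma>"] by simp
      then have "\<Phi> \<sigma> \<le> \<Phi> \<sigma> * indicator {\<tau> n t..<t} \<sigma>"
        using True by simp
      then have "\<Phi> \<sigma> \<le> (SUP n. \<Phi> \<sigma> * indicator {\<tau> n t..<t} \<sigma>)"
        by (rule SUP_upper2[OF UNIV_I])
      moreover have "(SUP n. \<Phi> \<sigma> * indicator {\<tau> n t..<t} \<sigma>) \<le> \<Phi> \<sigma>"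
        by (intro SUP_least) (auto simp: indicator_def)
      ultimately show ?thesis using True by simp
    next
      case False
      then have "\<sigma> \<notin> {\<tau> n t..<t}" for n
        unfolding \<tau>_def by (auto intro: less_le_trans[OF exp_gt_zero])
      then show ?thesis using False by simp
    qed
  qed
  also have "\<dots> = (SUP n. \<integral>\<^sup>+ \<sigma> \<in> {\<tau> n t..<t}. \<Phi> \<sigma> \<partial>lborel)"
  proof (rule nn_integral_monotone_convergence_SUP)
    show "incseq (\<lambda>n \<sigma>. \<Phi> \<sigma> * indicator {\<tau> n t..<t} \<sigma>)"
    proof (intro incseq_SucI le_funI mult_left_mono)
      fix n \<sigma>
      have "2 ^ n * (1 - ln t) \<le> 2 ^ Suc n * (1 - ln t)"
        using u by (intro mult_right_mono power_increasing) auto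
      then have "\<tau> (Suc n) t \<le> \<tau> n t" unfolding \<tau>_def by simp
      then show "indicator {\<tau> n t..<t} \<sigma> \<le> (indicator {\<tau> (Suc n) t..<t} \<sigma> :: ennreal)"
        by (auto simp: indicator_def)
    qed auto
  qed measurable
  also have "\<dots> \<le> epowr (ennreal C * 2 * hardy_integral K (1 / (1 - ln t))) p"
    using finite_blocks assms by (intro SUP_least) auto
  finally show ?thesis .
qed

lemma powr_mult_hardy_integral_le:
  assumes [measurable]: "K \<in> borel_measurable borel" and "0 < \<theta>" "0 < t" "t \<le> 1"
  shows "ennreal (t powr (- \<theta>)) * hardy_integral K t
    \<le> (\<integral>\<^sup>+ s \<in> {0<..<1}. ennreal (s powr (- \<theta>)) * K s * ennreal (1 / s) \<partial>lborel)"
  unfolding hardy_integral_def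
proof (subst nn_integral_cmult[symmetric])
  show "(\<integral>\<^sup>+ s. ennreal (t powr (- \<theta>)) * (K s * ennreal (1 / s) * indicator {0<..<t} s) \<partial>lborel)
    \<le> (\<integral>\<^sup>+ s \<in> {0<..<1}. ennreal (s powr (- \<theta>)) * K s * ennreal (1 / s) \<partial>lborel)"
  proof (rule nn_integral_mono)
    fix s :: real
    show "ennreal (t powr (- \<theta>)) * (K s * ennreal (1 / s) * indicator {0<..<t} s)
      \<le> ennreal (s powr (- \<theta>)) * K s * ennreal (1 / s) * indicator {0<..<1} s"
    proof (cases "s \<in> {0<..<t}")
      case True
      then have "t powr (- \<theta>) \<le> s powr (- \<theta>)"
        using assms by (intro powr_mono2') auto
      then show ?thesis
        using True assms by (auto simp: mult.assoc intro!: mult_right_mono ennreal_leI)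
    qed auto
  qed
qed measurable

text \<open>In Tonelli's theorem the condition \<open>s < (1 - ln t)^(-b)\<close> becomes \<open>t > exp (1 - s^(-1/b))\<close>, and
  the weight has mass at most \<open>s^(-\<theta>) / (\<theta> b)\<close> on the set of these \<open>t\<close>. Substituting
  \<open>x = (1 - ln t)^(-b)\<close> would turn this into the classical Hardy inequality on \<open>(0,1)\<close>.\<close>

lemma hardy_inequality_log:
  assumes [measurable]: "K \<in> borel_measurable borel" and "0 < \<theta>" "0 < b"
  shows "(\<integral>\<^sup>+ t \<in> {0<..<1}. ennreal (1 / t * (1 - ln t) powr (\<theta> * b - 1))
        * hardy_integral K ((1 - ln t) powr (- b)) \<partial>lborel)
    \<le> ennreal (1 / (\<theta> * b))
      * (\<integral>\<^sup>+ s \<in> {0<..<1}. ennreal (s powr (- \<theta>)) * K s * ennreal (1 / s) \<partial>lborel)"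
proof -
  define w where "w t = ennreal (1 / t * (1 - ln t) powr (\<theta> * b - 1))" for t
  define Z where "Z = {(t, s). 0 < t \<and> t < 1 \<and> 0 < s \<and> s < (1 - ln t) powr (- b :: real)}"
  have Z [measurable]: "Measurable.pred (lborel \<Otimes>\<^sub>M lborel) (\<lambda>x. x \<in> Z)"
    unfolding Z_def case_prod_beta mem_Collect_eq by measurable
  have w [measurable]: "w \<in> borel_measurable borel"
    unfolding w_def by measurable
  have inner: "(\<integral>\<^sup>+ t. w t * indicator Z (t, s) \<partial>lborel)
      \<le> ennreal (1 / (\<theta> * b)) * ennreal (s powr (- \<theta>)) * indicator {0<..<1} s" for s
  proof (cases "0 < s \<and> s < 1")
    case True
    define a where "a = exp (1 - s powr (- (1 / b)))"
    have "1 \<le> s powr (- (1 / b))"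
      using True assms powr_mono2'[of "- (1 / b)" s 1] by simp
    then have a: "0 < a" "a \<le> 1" by (simp_all add: a_def)
    have "a \<le> t" "t \<le> 1" if "(t, s) \<in> Z" for t
    proof -
      have t: "0 < t" "t < 1" "s < (1 - ln t) powr (- b)" using that by (auto simp: Z_def)
      have u: "1 < 1 - ln t" using ln_less_zero t by simp
      have "((1 - ln t) powr (- b)) powr (- (1 / b)) \<le> s powr (- (1 / b))"
        using t True assms by (intro powr_mono2') auto
      then have "1 - ln t \<le> s powr (- (1 / b))"
        using u assms by (simp add: powr_powr)
      then have "a \<le> exp (ln t)" unfolding a_def by simp
      then show "a \<le> t" "t \<le> 1" using t by simp_all
    qed
    then have "(\<integral>\<^sup>+ t. w t * indicator Z (t, s) \<partial>lborel) \<le> (\<integral>\<^sup>+ t. w t * indicator {a..1} t \<partial>lborel)"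
      by (intro nn_integral_mono) (auto simp: indicator_def)
    also have "\<dots> = ennreal (((1 - ln a) powr (\<theta> * b) - (1 - ln 1) powr (\<theta> * b)) / (\<theta> * b))"
      unfolding w_def using a assms by (intro nn_integral_log_powr) auto
    also have "\<dots> \<le> ennreal (1 / (\<theta> * b) * s powr (- \<theta>))"
    proof (rule ennreal_leI)
      have "(1 - ln a) powr (\<theta> * b) = s powr (- \<theta>)"
        using assms by (simp add: a_def powr_powr)
      then show "((1 - ln a) powr (\<theta> * b) - (1 - ln 1) powr (\<theta> * b)) / (\<theta> * b)
          \<le> 1 / (\<theta> * b) * s powr (- \<theta>)"
        using assms by (simp add: divide_right_mono)
    qed
    also have "\<dots> = ennreal (1 / (\<theta> * b)) * ennreal (s powr (- \<theta>))"
      using assms by (intro ennreal_mult) auto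
    finally show ?thesis using True by simp
  next
    case False
    have "(t, s) \<notin> Z" for t
    proof
      assume "(t, s) \<in> Z"
      then have t: "0 < t" "t < 1" "0 < s" "s < (1 - ln t) powr (- b)" by (auto simp: Z_def)
      have "(1 - ln t) powr (- b) \<le> 1"
        using ln_less_zero t assms powr_mono2'[of "- b" 1 "1 - ln t"] by simp
      then show False using t False by linarith
    qed
    then show ?thesis by simp
  qed
  have "(\<integral>\<^sup>+ t \<in> {0<..<1}. w t * hardy_integral K ((1 - ln t) powr (- b)) \<partial>lborel)
      = (\<integral>\<^sup>+ t. (\<integral>\<^sup>+ s. w t * (K s * ennreal (1 / s)) * indicator Z (t, s) \<partial>lborel) \<partial>lborel)"
  proof (rule nn_integral_cong)
    fix t :: real
    show "w t * hardy_integral K ((1 - ln t) powr (- b)) * indicator {0<..<1} t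
        = (\<integral>\<^sup>+ s. w t * (K s * ennreal (1 / s)) * indicator Z (t, s) \<partial>lborel)"
    proof (cases "t \<in> {0<..<1}")
      case True
      then have "w t * hardy_integral K ((1 - ln t) powr (- b)) * indicator {0<..<1} t
          = (\<integral>\<^sup>+ s. w t * (K s * ennreal (1 / s) * indicator {0<..<(1 - ln t) powr (- b)} s) \<partial>lborel)"
        unfolding hardy_integral_def by (subst nn_integral_cmult) auto
      also have "\<dots> = (\<integral>\<^sup>+ s. w t * (K s * ennreal (1 / s)) * indicator Z (t, s) \<partial>lborel)"
        using True by (intro nn_integral_cong) (auto simp: indicator_def Z_def mult.assoc)
      finally show ?thesis .
    next
      case False
      then have "(t, s) \<notin> Z" for s by (auto simp: Z_def)
      then show ?thesis using False by simp
    qed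
  qed
  also have "\<dots> = (\<integral>\<^sup>+ s. (\<integral>\<^sup>+ t. w t * (K s * ennreal (1 / s)) * indicator Z (t, s) \<partial>lborel) \<partial>lborel)"
    by (rule lborel_pair.Fubini') measurable
  also have "\<dots> = (\<integral>\<^sup>+ s. K s * ennreal (1 / s) * (\<integral>\<^sup>+ t. w t * indicator Z (t, s) \<partial>lborel) \<partial>lborel)"
    by (intro nn_integral_cong, subst nn_integral_cmult[symmetric]) (auto simp: mult_ac)
  also have "\<dots> \<le> (\<integral>\<^sup>+ s. K s * ennreal (1 / s)
      * (ennreal (1 / (\<theta> * b)) * ennreal (s powr (- \<theta>)) * indicator {0<..<1} s) \<partial>lborel)"
    by (intro nn_integral_mono mult_left_mono inner) auto
  also have "\<dots> = (\<integral>\<^sup>+ s. ennreal (1 / (\<theta> * b)) *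
      (ennreal (s powr (- \<theta>)) * K s * ennreal (1 / s) * indicator {0<..<1} s) \<partial>lborel)"
    by (simp only: mult_ac)
  also have "\<dots> = ennreal (1 / (\<theta> * b))
      * (\<integral>\<^sup>+ s \<in> {0<..<1}. ennreal (s powr (- \<theta>)) * K s * ennreal (1 / s) \<partial>lborel)"
    by (rule nn_integral_cmult) measurable
  finally show ?thesis unfolding w_def .
qed

text \<open>With \<open>x = u^(-b)\<close> the integrand is \<open>(x^(-\<theta>) H(t))^r / (t u)\<close>. One factor \<open>x^(-\<theta>) L(x)\<close> is
  integrated by the Hardy inequality, and the other \<open>r - 1\<close> factors are bounded by \<open>N\<close>.\<close>

lemma log_weighted_norm_le:
  assumes [measurable]: "K \<in> borel_measurable borel"
    and "0 < \<theta>" "0 < b" "1 \<le> r" "0 < C"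
    and H: "\<And>t. 0 < t \<Longrightarrow> t < 1 \<Longrightarrow> H t \<le> ennreal C * hardy_integral K ((1 - ln t) powr (- b))"
    and N: "N = (\<integral>\<^sup>+ s \<in> {0<..<1}. ennreal (s powr (- \<theta>)) * K s * ennreal (1 / s) \<partial>lborel)"
      "N < \<infinity>"
  shows "epowr (\<integral>\<^sup>+ t \<in> {0<..<1}. ennreal (1 / t * (1 - ln t) powr (r * \<theta> * b - 1)) * epowr (H t) r \<partial>lborel) (1 / r)
    \<le> ennreal (C * (1 / (\<theta> * b)) powr (1 / r)) * N"
proof -
  define L where "L t = hardy_integral K ((1 - ln t) powr (- b))" for t
  obtain n where n: "N = ennreal n" "0 \<le> n"
    using N(2) by (cases N) auto
  have ptw: "ennreal (1 / t * (1 - ln t) powr (r * \<theta> * b - 1)) * epowr (H t) r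
      \<le> ennreal (C powr r * n powr (r - 1)) * (ennreal (1 / t * (1 - ln t) powr (\<theta> * b - 1)) * L t)"
    if t: "0 < t" "t < 1" for t
  proof -
    define u where "u = 1 - ln t"
    have u: "1 < u" using ln_less_zero t by (simp add: u_def)
    have "ennreal (u powr (\<theta> * b)) * L t \<le> N"
    proof -
      have "u powr (- b) \<le> 1" using u assms powr_mono2'[of "- b" 1 u] by simp
      then show ?thesis
        using powr_mult_hardy_integral_le[of K \<theta> "u powr (- b)"] u assms
        by (simp add: powr_powr L_def u_def N(1) mult.commute)
    qed
    then have le: "epowr (ennreal (u powr (\<theta> * b)) * L t) r
        \<le> ennreal (u powr (\<theta> * b)) * L t * ennreal (n powr (r - 1))"
      using n assms by (intro epowr_le_mult_powr) auto
    have "ennreal (1 / t * u powr (r * \<theta> * b - 1)) * epowr (H t) r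
        \<le> ennreal (1 / t * u powr (r * \<theta> * b - 1)) * epowr (ennreal C * L t) r"
      using H[OF t] assms unfolding L_def by (intro mult_left_mono epowr_mono) auto
    also have "\<dots> = ennreal (C powr r * (1 / t * u powr (- 1))) * epowr (ennreal (u powr (\<theta> * b)) * L t) r"
    proof -
      have "u powr (r * \<theta> * b - 1) = u powr (- 1) * (u powr (\<theta> * b)) powr r"
        using u by (simp add: powr_powr mult_ac powr_diff powr_minus_divide)
      then have "ennreal (1 / t * u powr (r * \<theta> * b - 1)) * ennreal (C powr r)
          = ennreal (C powr r * (1 / t * u powr (- 1))) * ennreal ((u powr (\<theta> * b)) powr r)"
        using t by (simp add: mult_ac flip: ennreal_mult)
      then show ?thesis
        using assms by (simp only: epowr_mult epowr_ennreal[of C] epowr_ennreal[OF powr_ge_zero]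
            less_imp_le flip: mult.assoc)
    qed
    also have "\<dots> \<le> ennreal (C powr r * (1 / t * u powr (- 1)))
        * (ennreal (u powr (\<theta> * b)) * L t * ennreal (n powr (r - 1)))"
      by (intro mult_left_mono le) auto
    also have "\<dots> = ennreal (C powr r * n powr (r - 1)) * (ennreal (1 / t * u powr (\<theta> * b - 1)) * L t)"
    proof -
      have "u powr (\<theta> * b - 1) = u powr (- 1) * u powr (\<theta> * b)"
        using u by (simp add: powr_diff powr_minus_divide)
      then have eq: "ennreal (C powr r * (1 / t * u powr (- 1))) * ennreal (u powr (\<theta> * b)) * ennreal (n powr (r - 1))
          = ennreal (C powr r * n powr (r - 1)) * ennreal (1 / t * u powr (\<theta> * b - 1))"
        using t by (simp add: mult_ac flip: ennreal_mult)
      have swap: "X * (Y * L t * V) = X * Y * V * L t" for X Y V :: ennreal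
        by (simp only: mult_ac)
      show ?thesis
        by (subst swap, subst eq) (rule mult.assoc)
    qed
    finally show ?thesis unfolding u_def .
  qed
  have "(\<integral>\<^sup>+ t \<in> {0<..<1}. ennreal (1 / t * (1 - ln t) powr (r * \<theta> * b - 1)) * epowr (H t) r \<partial>lborel)
      \<le> (\<integral>\<^sup>+ t \<in> {0<..<1}. ennreal (C powr r * n powr (r - 1))
          * (ennreal (1 / t * (1 - ln t) powr (\<theta> * b - 1)) * L t) \<partial>lborel)"
    using ptw by (intro nn_integral_mono) (auto simp: indicator_def)
  also have "\<dots> = ennreal (C powr r * n powr (r - 1))
      * (\<integral>\<^sup>+ t \<in> {0<..<1}. ennreal (1 / t * (1 - ln t) powr (\<theta> * b - 1)) * L t \<partial>lborel)"
    unfolding L_def by (simp only: mult.assoc) (intro nn_integral_cmult, measurable)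
  also have "\<dots> \<le> ennreal (C powr r * n powr (r - 1)) * (ennreal (1 / (\<theta> * b)) * N)"
    unfolding L_def N(1) using assms by (intro mult_left_mono hardy_inequality_log) auto
  also have "\<dots> = ennreal ((C * (1 / (\<theta> * b)) powr (1 / r) * n) powr r)"
  proof -
    have "n powr r = n powr (r - 1) * n"
      using n(2) assms by (cases "n = 0") (auto simp: powr_diff)
    then have "(C * (1 / (\<theta> * b)) powr (1 / r) * n) powr r
        = C powr r * n powr (r - 1) * (1 / (\<theta> * b) * n)"
      using assms n(2) by (simp add: powr_mult powr_powr)
    then show ?thesis
      using n assms by (simp only: ennreal_mult[symmetric] powr_ge_zero) (simp flip: ennreal_mult)
  qed
  finally have "epowr (\<integral>\<^sup>+ t \<in> {0<..<1}. ennreal (1 / t * (1 - ln t) powr (r * \<theta> * b - 1)) * epowr (H t) r \<partial>lborel) (1 / r)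
      \<le> epowr (ennreal ((C * (1 / (\<theta> * b)) powr (1 / r) * n) powr r)) (1 / r)"
    using assms by (intro epowr_mono) auto
  also have "\<dots> = ennreal (C * (1 / (\<theta> * b)) powr (1 / r) * n)"
    using assms n(2) by (simp add: epowr_ennreal powr_powr)
  also have "\<dots> = ennreal (C * (1 / (\<theta> * b)) powr (1 / r)) * N"
    unfolding n(1) using assms n(2) by (intro ennreal_mult) auto
  finally show ?thesis .
qed

section \<open>The embedding\<close>

theorem theorem1p6:
  fixes \<Omega> :: "(real^'n) set" and p \<theta> r :: real
  assumes "open \<Omega>" and "bounded \<Omega>" and "emeasure lebesgue \<Omega> = 1"
    and "1 < p" and "0 < \<theta>" and "\<theta> < 1" and "1 \<le> r"
  shows "\<exists>c::real. c > 0 \<and>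
    (\<forall>f \<in> interp_space \<Omega> (weak_Lp_norm \<Omega> p) (small_Lp_norm \<Omega> p) \<theta> 1.
       inter_norm
         (GGamma_norm \<Omega> p r
            (\<lambda>t. 1 / t * (1 - ln t) powr (r * \<theta> - 1))
            (\<lambda>t. (1 - ln t) powr (- 1)))
         (GGamma_inf_norm \<Omega> r
            (\<lambda>t. 1 / t * (1 - ln t) powr (r * \<theta> * (1 - 1 / p) - 1))
            (\<lambda>t. t powr (1 / p))) f
       \<le> ennreal c * interp_norm \<Omega> (weak_Lp_norm \<Omega> p) (small_Lp_norm \<Omega> p) \<theta> 1 f)"
proof -
  define b where "b = 1 - 1 / p"
  have b: "0 < b" using assms by (simp add: b_def)
  have \<Omega>: "\<Omega> \<in> sets lebesgue" using assms(1) by (simp add: borel_open)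
  obtain C where C: "0 < C"
    "\<And>(Om :: (real^'n) set) f t. Om \<in> sets lebesgue \<Longrightarrow> 0 < t \<Longrightarrow> t < 1 \<Longrightarrow>
      (SUP s \<in> {0<..<t}. ennreal (s powr (1 / p)) * rearr Om f s)
      \<le> ennreal C * K_fun Om (weak_Lp_norm Om p) (small_Lp_norm Om p) f
          ((1 - ln t) powr (- (1 - 1 / p)))"
    by (rule sup_rearr_le_K_fun[OF assms(4), where 'n = 'n]) (rule that)
  obtain D where D: "0 < D"
    "\<And>(Om :: (real^'n) set) f t. Om \<in> sets lebesgue \<Longrightarrow> 0 < t \<Longrightarrow> t < 1 \<Longrightarrow>
      (\<integral>\<^sup>+ \<sigma> \<in> {exp (1 - 2 * (1 - ln t))..<t}.
        epowr (rearr Om f \<sigma>) p * ennreal ((1 - ln \<sigma>) powr (- 1)) \<partial>lborel)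
      \<le> epowr (ennreal D * K_fun Om (weak_Lp_norm Om p) (small_Lp_norm Om p) f (1 / (1 - ln t))) p"
    by (rule block_le_K_fun[OF assms(4), where 'n = 'n]) (rule that)
  define c1 where "c1 = D * 2 * (1 / (\<theta> * 1)) powr (1 / r)"
  define c2 where "c2 = C * 2 * (1 / (\<theta> * b)) powr (1 / r)"
  have c: "0 < c1" "0 < c2" using C(1) D(1) assms b by (auto simp: c1_def c2_def)
  show ?thesis
  proof (intro exI[of _ "c1 + c2"] conjI ballI)
    show "0 < c1 + c2" using c by simp
    fix f
    assume f: "f \<in> interp_space \<Omega> (weak_Lp_norm \<Omega> p) (small_Lp_norm \<Omega> p) \<theta> 1"
    define K where "K = K_fun \<Omega> (weak_Lp_norm \<Omega> p) (small_Lp_norm \<Omega> p) f"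
    define N where "N = interp_norm \<Omega> (weak_Lp_norm \<Omega> p) (small_Lp_norm \<Omega> p) \<theta> 1 f"
    have K [measurable]: "K \<in> borel_measurable borel" unfolding K_def by measurable
    have K_div: "ennreal (1 / t) * K t \<le> ennreal (1 / s) * K s" if "0 < s" "s \<le> t" for s t
      unfolding K_def using that by (rule K_fun_div_antimono)
    have N: "N = (\<integral>\<^sup>+ s \<in> {0<..<1}. ennreal (s powr (- \<theta>)) * K s * ennreal (1 / s) \<partial>lborel)"
      unfolding N_def interp_norm_def K_def by simp
    have N_finite: "N < \<infinity>" using f by (simp add: interp_space_def N_def)
    define \<Phi> where "\<Phi> \<sigma> = epowr (rearr \<Omega> f \<sigma>) p * ennreal ((1 - ln \<sigma>) powr (- 1))" for \<sigma>
    have \<Phi> [measurable]: "\<Phi> \<in> borel_measurable borel" unfolding \<Phi>_def by measurable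
    define G where "G t = epowr (\<integral>\<^sup>+ \<sigma> \<in> {0<..<t}. \<Phi> \<sigma> \<partial>lborel) (1 / p)" for t
    define S where "S t = (SUP s \<in> {0<..<t}. ennreal (s powr (1 / p)) * rearr \<Omega> f s)" for t
    have G: "G t \<le> ennreal (D * 2) * hardy_integral K ((1 - ln t) powr (- 1))" if t: "0 < t" "t < 1" for t
    proof -
      have "(\<integral>\<^sup>+ \<sigma> \<in> {0<..<t}. \<Phi> \<sigma> \<partial>lborel)
          \<le> epowr (ennreal D * 2 * hardy_integral K (1 / (1 - ln t))) p"
      proof (rule integral_le_hardy_integral_of_blocks[OF \<Phi> K K_div])
        fix t :: real
        assume "0 < t" "t < 1"
        then show "(\<integral>\<^sup>+ \<sigma> \<in> {exp (1 - 2 * (1 - ln t))..<t}. \<Phi> \<sigma> \<partial>lborel)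
            \<le> epowr (ennreal D * K (1 / (1 - ln t))) p"
          unfolding \<Phi>_def K_def by (rule D(2)[OF \<Omega>])
      qed (use t assms in auto)
      from epowr_mono[OF this, of "1 / p"]
      have "G t \<le> ennreal D * 2 * hardy_integral K (1 / (1 - ln t))"
        unfolding G_def using assms by (simp add: epowr_inverse_cancel)
      also have "1 / (1 - ln t) = (1 - ln t) powr (- 1)"
        using ln_less_zero[OF t] by (simp add: powr_minus_divide)
      also have "ennreal D * 2 = ennreal (D * 2)"
        using D(1) by (simp add: ennreal_mult)
      finally show ?thesis .
    qed
    have S: "S t \<le> ennreal (C * 2) * hardy_integral K ((1 - ln t) powr (- b))" if t: "0 < t" "t < 1" for t
    proof -
      define v where "v = (1 - ln t) powr (- b)"
      have v: "0 < v" using ln_less_zero[OF t] by (simp add: v_def)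
      have "S t \<le> ennreal C * K v"
        unfolding S_def v_def b_def K_def by (rule C(2)[OF \<Omega> t])
      also have "\<dots> \<le> ennreal C * (2 * (\<integral>\<^sup>+ s \<in> {v / 2..<v}. K s * ennreal (1 / s) \<partial>lborel))"
        using v by (intro mult_left_mono le_integral_dyadic K_div) auto
      also have "\<dots> \<le> ennreal C * (2 * hardy_integral K v)"
        using v by (intro mult_left_mono) (auto simp: hardy_integral_halve[OF K v])
      also have "\<dots> = ennreal (C * 2) * hardy_integral K v"
        using C(1) by (simp add: ennreal_mult mult.assoc)
      finally show ?thesis unfolding v_def .
    qed
    have le: "ennreal c1 * N \<le> ennreal (c1 + c2) * N" "ennreal c2 * N \<le> ennreal (c1 + c2) * N"
      using c by (auto intro!: mult_right_mono ennreal_leI)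
    have "GGamma_norm \<Omega> p r (\<lambda>t. 1 / t * (1 - ln t) powr (r * \<theta> - 1)) (\<lambda>t. (1 - ln t) powr (- 1)) f
        \<le> ennreal c1 * N"
    proof -
      have "epowr (\<integral>\<^sup>+ t \<in> {0<..<1}. ennreal (1 / t * (1 - ln t) powr (r * \<theta> * 1 - 1)) * epowr (G t) r \<partial>lborel) (1 / r)
          \<le> ennreal (D * 2 * (1 / (\<theta> * 1)) powr (1 / r)) * N"
        using D(1) assms by (intro log_weighted_norm_le[OF K _ _ _ _ G N N_finite]) auto
      moreover have "epowr (G t) r = epowr (\<integral>\<^sup>+ \<sigma> \<in> {0<..<t}. \<Phi> \<sigma> \<partial>lborel) (r / p)" for t
        by (simp add: G_def epowr_epowr)
      ultimately show ?thesis
        unfolding GGamma_norm_def c1_def \<Phi>_def by (simp only: mult_1_right)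
    qed
    moreover have "GGamma_inf_norm \<Omega> r (\<lambda>t. 1 / t * (1 - ln t) powr (r * \<theta> * (1 - 1 / p) - 1)) (\<lambda>t. t powr (1 / p)) f
        \<le> ennreal c2 * N"
      unfolding GGamma_inf_norm_def S_def[symmetric] b_def[symmetric] c2_def
      using C(1) assms b by (intro log_weighted_norm_le[OF K _ _ _ _ S N N_finite]) auto
    ultimately show "inter_norm
         (GGamma_norm \<Omega> p r
            (\<lambda>t. 1 / t * (1 - ln t) powr (r * \<theta> - 1))
            (\<lambda>t. (1 - ln t) powr (- 1)))
         (GGamma_inf_norm \<Omega> r
            (\<lambda>t. 1 / t * (1 - ln t) powr (r * \<theta> * (1 - 1 / p) - 1))
            (\<lambda>t. t powr (1 / p))) f
       \<le> ennreal (c1 + c2) * interp_norm \<Omega> (weak_Lp_norm \<Omega> p) (small_Lp_norm \<Omega> p) \<theta> 1 f"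
      unfolding inter_norm_def N_def[symmetric] using le by (auto intro: order_trans)
  qed
qed
end
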